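(* For any $P,N>0$ with $\frac NP\le\frac{L-1}{L}$ and any $L\in\mathbb{Z}_{\ge2}$, $$\overline{C}_{L-1}(P,N)\ge\frac12\left[\ln\frac{(L-1)P}{LN}+\frac1{L-1}\ln\frac{P}{L(P-N)}\right].$$
   Context: $\mathcal{B}^n(r)$ is the closed Euclidean ball of radius $r$ centered at the origin. For $x_1,\dots,x_L\in\mathbb{R}^n$ with centroid $\bar x=\frac1L\sum_ix_i$, $\overline{\mathrm{rad}}^2(x_1,\dots,x_L)=\frac1L\sum_i\|x_i-\bar x\|_2^2$. A finite $\mathcal{C}\subseteq\mathcal{B}^n(\sqrt{nP})$ is $(P,N,L-1)$-average-radius list-decodable if every $L$ distinct points of $\mathcal{C}$ have $\overline{\mathrm{rad}}^2>nN$. Rate $R(\mathcal{C})=\frac1n\ln|\mathcal{C}|$. $\overline{C}_{L-1}(P,N)=\limsup_{n\to\infty}\sup R(\mathcal{C})$ over such codes in $\mathcal{B}^n(\sqrt{nP})$. *)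

theory Defs
  imports "HOL-Analysis.Analysis"
begin

definition in_Rn :: "nat \<Rightarrow> (nat \<Rightarrow> real) \<Rightarrow> bool" where
  "in_Rn n x \<longleftrightarrow> (\<forall>i\<ge>n. x i = 0)"

definition sqnorm :: "nat \<Rightarrow> (nat \<Rightarrow> real) \<Rightarrow> real" where
  "sqnorm n x = (\<Sum>i<n. (x i)\<^sup>2)"

definition ballN :: "nat \<Rightarrow> real \<Rightarrow> (nat \<Rightarrow> real) set" where
  "ballN n r = {x. in_Rn n x \<and> sqrt (sqnorm n x) \<le> r}"

definition centroid :: "(nat \<Rightarrow> real) set \<Rightarrow> (nat \<Rightarrow> real)" where
  "centroid S = (\<lambda>i. (1 / real (card S)) * (\<Sum>x\<in>S. x i))"

definition avg_rad_sq :: "nat \<Rightarrow> (nat \<Rightarrow> real) set \<Rightarrow> real" where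
  "avg_rad_sq n S = (1 / real (card S)) * (\<Sum>x\<in>S. sqnorm n (\<lambda>i. x i - centroid S i))"

definition list_decodable :: "nat \<Rightarrow> real \<Rightarrow> real \<Rightarrow> nat \<Rightarrow> (nat \<Rightarrow> real) set \<Rightarrow> bool" where
  "list_decodable n P N L C \<longleftrightarrow> finite C \<and> C \<subseteq> ballN n (sqrt (real n * P)) \<and>
     (\<forall>S. S \<subseteq> C \<and> card S = L \<longrightarrow> avg_rad_sq n S > real n * N)"

definition code_rate :: "nat \<Rightarrow> (nat \<Rightarrow> real) set \<Rightarrow> real" where
  "code_rate n C = ln (real (card C)) / real n"

definition list_capacity :: "nat \<Rightarrow> real \<Rightarrow> real \<Rightarrow> ereal" where
  "list_capacity L P N = limsup (\<lambda>n. SUP C\<in>{C. list_decodable n P N L C}. ereal (code_rate n C))"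

end

theory Submission
  imports Defs "HOL-Probability.Probability"
begin

text \<open>
  Random coding with expurgation. Draw \<open>M\<close> independent standard Gaussian vectors in dimension \<open>n\<close>.
  Their squared norms concentrate at \<open>n\<close>. Put \<open>\<rho> = N / P\<close>, \<open>a = L (1 - \<rho>)\<close> and
  \<open>b = L \<rho> / (L - 1)\<close>. An \<open>L\<close>-tuple of vectors of squared norm about \<open>n\<close> whose squared average radius is
  at most \<open>\<rho> n\<close> is penalised by the Chernoff weight
  \<open>exp (\<beta> \<Sum> |x\<^sub>i|\<^sup>2 - \<alpha> \<Sum> |x\<^sub>i - m|\<^sup>2)\<close>, \<open>m\<close> being the centroid. The choice \<open>\<alpha> = (1/b - 1/a)/2\<close>,
  \<open>\<beta> = (1 - 1/a)/2\<close> tilts the Gaussian to variance \<open>a\<close> along the diagonal and \<open>b\<close> orthogonally to it,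
  and gives the probability bound \<open>(a b\<^bsup>L-1\<^esup>)\<^bsup>n/2\<^esup>\<close> up to subexponential factors. Hence \<open>M\<close> may grow like the
  \<open>(L - 1)\<close>-st root of its inverse before deleting one vector from every bad tuple costs more than half
  of the code. Rescaling by slightly less than \<open>sqrt P\<close> puts the code into the ball.
\<close>

section \<open>Exponential moments of quadratic forms in independent Gaussians\<close>

abbreviation gauss :: "real measure" where
  "gauss \<equiv> density lborel (\<lambda>x. ennreal (std_normal_density x))"

lemma prob_space_gauss: "prob_space gauss"
  by (rule prob_space_normal_density) simp

text \<open>Completing the square: with \<open>d = 1 + 2 * \<gamma>\<close>, density times integrand
  is a constant multiple of the normal density with mean \<open>t / d\<close> and variance
  \<open>1 / d\<close>; that constant is the integral.\<close>

lemma nn_integral_gauss_exp_quadratic: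
  fixes t \<gamma> :: real
  assumes "1 + 2 * \<gamma> > 0"
  shows "(\<integral>\<^sup>+ x. ennreal (exp (t * x - \<gamma> * x\<^sup>2)) \<partial>gauss)
       = ennreal (exp (t\<^sup>2 / (2 * (1 + 2 * \<gamma>))) / sqrt (1 + 2 * \<gamma>))"
proof -
  define d where "d = 1 + 2 * \<gamma>"
  have d: "d > 0" using assms by (simp add: d_def)
  have g: "\<gamma> = (d - 1) / 2" by (simp add: d_def)
  define K where "K = exp (t\<^sup>2 / (2 * d)) / sqrt d"
  have K: "K \<ge> 0" using d by (simp add: K_def)
  have ex: "t * x - \<gamma> * x\<^sup>2 - x\<^sup>2 / 2 = t\<^sup>2 / (2 * d) - (x - t / d)\<^sup>2 / (2 * (1 / sqrt d)\<^sup>2)" for x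
    using d by (simp add: g power2_eq_square field_simps)
  have dens: "std_normal_density x * exp (t * x - \<gamma> * x\<^sup>2) = K * normal_density (t / d) (1 / sqrt d) x" for x
  proof -
    have "std_normal_density x * exp (t * x - \<gamma> * x\<^sup>2)
        = 1 / sqrt (2 * pi) * exp (t * x - \<gamma> * x\<^sup>2 - x\<^sup>2 / 2)"
      by (simp add: std_normal_density_def exp_add[symmetric] algebra_simps exp_diff exp_minus divide_simps)
    also have "\<dots> = 1 / sqrt (2 * pi) * (exp (t\<^sup>2 / (2 * d)) * exp (- (x - t / d)\<^sup>2 / (2 * (1 / sqrt d)\<^sup>2)))"
      unfolding ex by (simp add: exp_add[symmetric])
    also have "\<dots> = K * normal_density (t / d) (1 / sqrt d) x"
      using d by (simp add: K_def normal_density_def real_sqrt_divide real_sqrt_mult field_simps)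
    finally show ?thesis .
  qed
  have "(\<integral>\<^sup>+ x. ennreal (exp (t * x - \<gamma> * x\<^sup>2)) \<partial>gauss)
      = (\<integral>\<^sup>+ x. ennreal (std_normal_density x) * ennreal (exp (t * x - \<gamma> * x\<^sup>2)) \<partial>lborel)"
    by (subst nn_integral_density) auto
  also have "\<dots> = (\<integral>\<^sup>+ x. ennreal K * ennreal (normal_density (t / d) (1 / sqrt d) x) \<partial>lborel)"
    using K by (intro nn_integral_cong) (simp add: ennreal_mult'[symmetric] dens[symmetric])
  also have "\<dots> = ennreal K * (\<integral>\<^sup>+ x. ennreal (normal_density (t / d) (1 / sqrt d) x) \<partial>lborel)"
    by (rule nn_integral_cmult) auto
  also have "(\<integral>\<^sup>+ x. ennreal (normal_density (t / d) (1 / sqrt d) x) \<partial>lborel) = ennreal 1"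
    using d by (subst nn_integral_eq_integral) (auto simp: integral_normal_density)
  finally show ?thesis by (simp add: K_def d_def)
qed

text \<open>Collects one coordinate of all \<open>M\<close> codewords; in
  \<open>gauss_matrix\<close> the entry \<open>\<omega> j i\<close> is coordinate \<open>j\<close>
  of codeword \<open>i\<close>. With coordinates outermost, exponentials of forms that couple
  codewords split into independent factors over \<open>j\<close>.\<close>

abbreviation gauss_vec :: "nat \<Rightarrow> (nat \<Rightarrow> real) measure" where
  "gauss_vec M \<equiv> Pi\<^sub>M {..<M} (\<lambda>_. gauss)"

abbreviation gauss_matrix :: "nat \<Rightarrow> nat \<Rightarrow> (nat \<Rightarrow> nat \<Rightarrow> real) measure" where
  "gauss_matrix n M \<equiv> Pi\<^sub>M {..<n} (\<lambda>_. gauss_vec M)"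

lemma prob_space_gauss_vec: "prob_space (gauss_vec M)"
  by (rule prob_space_PiM) (rule prob_space_gauss)

lemma prob_space_gauss_matrix: "prob_space (gauss_matrix n M)"
  by (rule prob_space_PiM) (rule prob_space_gauss_vec)

lemma measurable_gauss_vec_component [measurable (raw)]:
  "i < M \<Longrightarrow> (\<lambda>c. c i) \<in> borel_measurable (gauss_vec M)"
  using measurable_component_singleton[of i "{..<M}" "\<lambda>_. gauss"] by simp

text \<open>A Gaussian integral with precision matrix
  \<open>(1 + 2 * \<gamma>) I - 2 * \<kappa> J\<close>, \<open>J\<close> being the all-ones matrix
  on \<open>T\<close>. For nonempty \<open>T\<close> the eigenvalue is
  \<open>1 + 2 * \<gamma> - 2 * \<kappa> * card T\<close> along the diagonal and
  \<open>1 + 2 * \<gamma>\<close> orthogonally to it. The value is the determinant to the power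
  -1/2, and the last hypothesis is positivity on the diagonal.\<close>

lemma nn_integral_gauss_vec_exp_quadratic:
  fixes \<kappa> \<gamma> :: real
  assumes T: "T \<subseteq> {..<M}" and \<kappa>: "\<kappa> \<ge> 0" and \<gamma>: "1 + 2 * \<gamma> > 0"
    and \<kappa>\<gamma>: "2 * \<kappa> * card T < 1 + 2 * \<gamma>"
  shows "(\<integral>\<^sup>+ c. ennreal (exp (\<kappa> * (\<Sum>i\<in>T. c i)\<^sup>2 - \<gamma> * (\<Sum>i\<in>T. (c i)\<^sup>2))) \<partial>gauss_vec M)
       = ennreal ((1 / sqrt (1 + 2 * \<gamma>)) ^ card T / sqrt (1 - 2 * \<kappa> * card T / (1 + 2 * \<gamma>)))"
proof -
  interpret G: prob_space gauss by (rule prob_space_gauss)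
  interpret V: prob_space "gauss_vec M" by (rule prob_space_gauss_vec)
  interpret PS: product_sigma_finite "\<lambda>_::nat. gauss" by standard
  interpret pair_sigma_finite "gauss_vec M" gauss by standard
  define d where "d = 1 + 2 * \<gamma>"
  have d: "d > 0" using \<gamma> by (simp add: d_def)
  \<comment> \<open>Chosen so that the Gaussian moment \<open>exp ((u * s)^2 / 2)\<close> equals
    \<open>exp (\<kappa> * s^2)\<close>.\<close>
  define u where "u = sqrt (2 * \<kappa>)"
  have u2: "u\<^sup>2 = 2 * \<kappa>" using \<kappa> by (simp add: u_def)
  have fT: "finite T" using T finite_subset by blast
  have comp: "(\<lambda>x. fst x i) \<in> borel_measurable (gauss_vec M \<Otimes>\<^sub>M gauss)" if "i \<in> T" for i
    using measurable_compose[OF measurable_fst measurable_gauss_vec_component] that T by blast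
  define H where "H = (\<lambda>c g. ennreal (exp (u * g * (\<Sum>i\<in>T. c i) - \<gamma> * (\<Sum>i\<in>T. (c i)\<^sup>2))))"
  have Hm: "(\<lambda>(c, g). H c g) \<in> borel_measurable (gauss_vec M \<Otimes>\<^sub>M gauss)"
    unfolding H_def split_beta using comp
    by (intro measurable_compose[OF _ measurable_ennreal] borel_measurable_exp[THEN measurable_compose[rotated]]
         borel_measurable_diff borel_measurable_times borel_measurable_sum borel_measurable_power) auto
  \<comment> \<open>Hubbard-Stratonovich: an auxiliary Gaussian \<open>g\<close> linearises the square of the sum,
    so that the components decouple.\<close>
  have hs: "ennreal (exp (\<kappa> * (\<Sum>i\<in>T. c i)\<^sup>2 - \<gamma> * (\<Sum>i\<in>T. (c i)\<^sup>2))) = (\<integral>\<^sup>+ g. H c g \<partial>gauss)" for c :: "nat \<Rightarrow> real"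
  proof -
    define s where "s = (\<Sum>i\<in>T. c i)"
    define w where "w = exp (- \<gamma> * (\<Sum>i\<in>T. (c i)\<^sup>2))"
    have "(\<integral>\<^sup>+ g. H c g \<partial>gauss) = (\<integral>\<^sup>+ g. ennreal w * ennreal (exp ((u * s) * g - 0 * g\<^sup>2)) \<partial>gauss)"
      unfolding H_def w_def
      by (intro nn_integral_cong) (simp add: ennreal_mult'[symmetric] exp_add[symmetric] s_def mult_ac)
    also have "\<dots> = ennreal w * ennreal (exp ((u * s)\<^sup>2 / 2))"
      by (subst nn_integral_cmult) (auto simp: nn_integral_gauss_exp_quadratic[of 0 "u * s", simplified])
    also have "\<dots> = ennreal (exp (\<kappa> * s\<^sup>2 - \<gamma> * (\<Sum>i\<in>T. (c i)\<^sup>2)))"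
      by (simp add: w_def ennreal_mult'[symmetric] exp_add[symmetric] power_mult_distrib u2)
    finally show ?thesis by (simp add: s_def)
  qed
  \<comment> \<open>Given \<open>g\<close>, each index in \<open>T\<close> contributes
    \<open>exp (\<kappa> * g^2 / d) / sqrt d\<close> and every other index the total mass 1. The
    zero linear term matches the one-dimensional formula, which is used once more for the integral
    over \<open>g\<close>.\<close>
  have inner: "(\<integral>\<^sup>+ c. H c g \<partial>gauss_vec M)
      = ennreal ((1 / sqrt d) ^ card T) * ennreal (exp (0 * g - (- (\<kappa> * card T / d)) * g\<^sup>2))" for g
  proof -
    define f where "f = (\<lambda>i x. if i \<in> T then ennreal (exp ((u * g) * x - \<gamma> * x\<^sup>2)) else 1)"
    have "H c g = (\<Prod>i<M. f i (c i))" for c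
    proof -
      have "(\<Prod>i<M. f i (c i)) = (\<Prod>i\<in>T. ennreal (exp ((u * g) * c i - \<gamma> * (c i)\<^sup>2)))"
        using T by (intro prod.mono_neutral_cong_right) (auto simp: f_def)
      also have "\<dots> = ennreal (\<Prod>i\<in>T. exp ((u * g) * c i - \<gamma> * (c i)\<^sup>2))"
        by (rule prod_ennreal) simp
      also have "\<dots> = H c g"
        using fT by (simp add: H_def exp_sum[symmetric] sum_subtractf sum_distrib_left)
      finally show ?thesis by simp
    qed
    hence "(\<integral>\<^sup>+ c. H c g \<partial>gauss_vec M) = (\<integral>\<^sup>+ c. (\<Prod>i<M. f i (c i)) \<partial>gauss_vec M)" by simp
    also have "\<dots> = (\<Prod>i<M. \<integral>\<^sup>+ x. f i x \<partial>gauss)"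
      by (rule PS.product_nn_integral_prod) (auto simp: f_def)
    also have "\<dots> = (\<Prod>i\<in>T. \<integral>\<^sup>+ x. ennreal (exp ((u * g) * x - \<gamma> * x\<^sup>2)) \<partial>gauss)"
      using T G.emeasure_space_1 by (intro prod.mono_neutral_cong_right) (auto simp: f_def)
    also have "\<dots> = ennreal (exp ((u * g)\<^sup>2 / (2 * d)) / sqrt d) ^ card T"
      using nn_integral_gauss_exp_quadratic[OF \<gamma>] by (simp add: d_def)
    also have "\<dots> = ennreal ((exp ((u * g)\<^sup>2 / (2 * d)) / sqrt d) ^ card T)"
      using d by (simp add: ennreal_power)
    also have "(exp ((u * g)\<^sup>2 / (2 * d)) / sqrt d) ^ card T
        = (1 / sqrt d) ^ card T * exp (0 * g - (- (\<kappa> * card T / d)) * g\<^sup>2)"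
      by (simp add: power_divide exp_of_nat_mult[symmetric] power_mult_distrib u2 mult_ac)
    finally show ?thesis by (simp add: ennreal_mult'[symmetric] ennreal_mult''[symmetric])
  qed
  have "(\<integral>\<^sup>+ c. ennreal (exp (\<kappa> * (\<Sum>i\<in>T. c i)\<^sup>2 - \<gamma> * (\<Sum>i\<in>T. (c i)\<^sup>2))) \<partial>gauss_vec M)
      = (\<integral>\<^sup>+ g. (\<integral>\<^sup>+ c. H c g \<partial>gauss_vec M) \<partial>gauss)"
    unfolding hs by (rule Fubini'[OF Hm, symmetric])
  also have "\<dots> = ennreal ((1 / sqrt d) ^ card T)
      * (\<integral>\<^sup>+ g. ennreal (exp (0 * g - (- (\<kappa> * card T / d)) * g\<^sup>2)) \<partial>gauss)"
    unfolding inner by (rule nn_integral_cmult) auto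
  also have "\<dots> = ennreal ((1 / sqrt d) ^ card T) * ennreal (1 / sqrt (1 - 2 * \<kappa> * card T / d))"
  proof -
    have "2 * \<kappa> * card T < d" using \<kappa>\<gamma> by (simp add: d_def)
    thus ?thesis
      using d by (subst nn_integral_gauss_exp_quadratic) (auto simp: field_simps)
  qed
  finally show ?thesis
    using d by (simp add: d_def[symmetric] ennreal_mult'[symmetric])
qed

text \<open>Both Chernoff weights come from this family: a singleton \<open>T\<close> with
  \<open>\<kappa> = 0\<close> tests one squared norm, an \<open>L\<close>-element \<open>T\<close>
  with \<open>\<kappa> = \<alpha> / L\<close> weighs the spread of a tuple against its
  norms.\<close>

definition quad_form :: "nat \<Rightarrow> (nat \<Rightarrow> nat \<Rightarrow> real) \<Rightarrow> nat set \<Rightarrow> real \<Rightarrow> real \<Rightarrow> real" where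
  "quad_form n \<omega> T \<kappa> \<gamma> = (\<Sum>j<n. \<kappa> * (\<Sum>i\<in>T. \<omega> j i)\<^sup>2 - \<gamma> * (\<Sum>i\<in>T. (\<omega> j i)\<^sup>2))"

lemma measurable_quad_form:
  assumes T: "T \<subseteq> {..<M}"
  shows "(\<lambda>\<omega>. quad_form n \<omega> T \<kappa> \<gamma>) \<in> borel_measurable (gauss_matrix n M)"
proof -
  have "(\<lambda>\<omega>. \<omega> j i) \<in> borel_measurable (gauss_matrix n M)" if "j < n" "i \<in> T" for j i
    using measurable_compose[OF measurable_component_singleton[of j "{..<n}" "\<lambda>_. gauss_vec M"]
        measurable_gauss_vec_component[of i M]] that T by auto
  thus ?thesis
    unfolding quad_form_def
    by (intro borel_measurable_diff borel_measurable_times borel_measurable_sum borel_measurable_power) auto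
qed

lemma nn_integral_exp_quad_form:
  fixes \<kappa> \<gamma> :: real
  assumes T: "T \<subseteq> {..<M}" and \<kappa>: "\<kappa> \<ge> 0" and \<gamma>: "1 + 2 * \<gamma> > 0"
    and \<kappa>\<gamma>: "2 * \<kappa> * card T < 1 + 2 * \<gamma>"
  shows "(\<integral>\<^sup>+ \<omega>. ennreal (exp (quad_form n \<omega> T \<kappa> \<gamma>)) \<partial>gauss_matrix n M)
       = ennreal (((1 / sqrt (1 + 2 * \<gamma>)) ^ card T / sqrt (1 - 2 * \<kappa> * card T / (1 + 2 * \<gamma>))) ^ n)"
proof -
  interpret V: prob_space "gauss_vec M" by (rule prob_space_gauss_vec)
  interpret PS: product_sigma_finite "\<lambda>_::nat. gauss_vec M" by standard
  have comp1: "(\<lambda>x. x i) \<in> borel_measurable (gauss_vec M)" if "i \<in> T" for i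
    using measurable_gauss_vec_component that T by blast
  define f where "f = (\<lambda>c::nat \<Rightarrow> real. ennreal (exp (\<kappa> * (\<Sum>i\<in>T. c i)\<^sup>2 - \<gamma> * (\<Sum>i\<in>T. (c i)\<^sup>2))))"
  have fm: "f \<in> borel_measurable (gauss_vec M)"
    unfolding f_def using comp1
    by (intro measurable_compose[OF _ measurable_ennreal] borel_measurable_exp[THEN measurable_compose[rotated]]
         borel_measurable_diff borel_measurable_times borel_measurable_sum borel_measurable_power) auto
  have "ennreal (exp (quad_form n \<omega> T \<kappa> \<gamma>)) = (\<Prod>j<n. f (\<omega> j))" for \<omega>
    unfolding f_def quad_form_def by (subst prod_ennreal) (auto simp: exp_sum)
  hence "(\<integral>\<^sup>+ \<omega>. ennreal (exp (quad_form n \<omega> T \<kappa> \<gamma>)) \<partial>gauss_matrix n M)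
      = (\<integral>\<^sup>+ \<omega>. (\<Prod>j<n. f (\<omega> j)) \<partial>gauss_matrix n M)" by simp
  also have "\<dots> = (\<Prod>j<n. \<integral>\<^sup>+ c. f c \<partial>gauss_vec M)"
    by (rule PS.product_nn_integral_prod) (auto simp: fm)
  also have "\<dots> = ennreal ((1 / sqrt (1 + 2 * \<gamma>)) ^ card T / sqrt (1 - 2 * \<kappa> * card T / (1 + 2 * \<gamma>))) ^ n"
    unfolding f_def nn_integral_gauss_vec_exp_quadratic[OF assms] by simp
  also have "\<dots> = ennreal (((1 / sqrt (1 + 2 * \<gamma>)) ^ card T / sqrt (1 - 2 * \<kappa> * card T / (1 + 2 * \<gamma>))) ^ n)"
    using \<gamma> \<kappa>\<gamma> by (subst ennreal_power) (auto simp: field_simps)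
  finally show ?thesis .
qed

section \<open>First-moment existence and deletion\<close>

lemma (in prob_space) exists_less_of_nn_integral_less:
  fixes f :: "'a \<Rightarrow> real"
  assumes "(\<integral>\<^sup>+ x. ennreal (f x) \<partial>M) < ennreal c"
  shows "\<exists>x\<in>space M. f x < c"
proof (rule ccontr)
  assume "\<not> ?thesis"
  hence "(\<integral>\<^sup>+ x. ennreal c \<partial>M) \<le> (\<integral>\<^sup>+ x. ennreal (f x) \<partial>M)"
    by (intro nn_integral_mono ennreal_leI) (auto simp: not_less)
  thus False using assms by (simp add: emeasure_space_1)
qed

text \<open>Deleting one representative of each forbidden set destroys that set;
  \<open>{} \<notin> \<T>\<close> provides the representative, and shared representatives only
  help.\<close>

lemma expurgation:
  fixes A B :: "'a set"
  assumes A: "finite A" and B: "B \<subseteq> A" and \<T>: "finite \<T>" "{} \<notin> \<T>"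
  shows "\<exists>J\<subseteq>A - B. (\<forall>T\<in>\<T>. \<not> T \<subseteq> J) \<and> card A \<le> card J + card B + card \<T>"
proof -
  define r where "r T = (SOME i. i \<in> T)" for T :: "'a set"
  have r: "r T \<in> T" if "T \<in> \<T>" for T
    unfolding r_def using that \<T>(2) by (metis some_in_eq)
  define J where "J = A - B - r ` \<T>"
  have "card A \<le> card (J \<union> B \<union> r ` \<T>)"
    using A B \<T> by (intro card_mono) (auto simp: J_def intro: finite_subset)
  also have "\<dots> \<le> card J + card B + card (r ` \<T>)"
    by (meson card_Un_le add_le_mono le_trans order_refl)
  also have "\<dots> \<le> card J + card B + card \<T>"
    using card_image_le[OF \<T>(1)] by simp
  finally have "card A \<le> card J + card B + card \<T>" .
  moreover have "\<forall>T\<in>\<T>. \<not> T \<subseteq> J" using r by (auto simp: J_def)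
  ultimately show ?thesis by (intro exI[of _ J]) (auto simp: J_def)
qed

section \<open>Average radius and codes with coinciding points\<close>

text \<open>For distinct points this is \<open>card T\<close> times the squared average radius; unlike
  \<^const>\<open>avg_rad_sq\<close> it counts repeated points with multiplicity.\<close>
definition spread :: "nat \<Rightarrow> (nat \<Rightarrow> nat \<Rightarrow> real) \<Rightarrow> nat set \<Rightarrow> real" where
  "spread n x T = (\<Sum>j<n. (\<Sum>i\<in>T. (x i j)\<^sup>2) - (\<Sum>i\<in>T. x i j)\<^sup>2 / card T)"

text \<open>In each coordinate, the squared deviations from the mean add up to the sum of squares
  minus the squared sum divided by the number of points.\<close>

lemma avg_rad_sq_image:
  assumes "inj_on x T" and "card T > 0"
  shows "avg_rad_sq n (x ` T) = spread n x T / card T"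
proof -
  define L where "L = real (card T)"
  have L: "L > 0" using assms by (simp add: L_def)
  have c: "centroid (x ` T) j = (\<Sum>i\<in>T. x i j) / L" for j
    using assms by (simp add: centroid_def card_image sum.reindex L_def)
  have col: "(\<Sum>i\<in>T. (x i j - (\<Sum>i\<in>T. x i j) / L)\<^sup>2) = (\<Sum>i\<in>T. (x i j)\<^sup>2) - (\<Sum>i\<in>T. x i j)\<^sup>2 / L" for j
  proof -
    define s where "s = (\<Sum>i\<in>T. x i j)"
    have "(\<Sum>i\<in>T. (x i j - s / L)\<^sup>2) = (\<Sum>i\<in>T. (x i j)\<^sup>2) - 2 * (s / L) * s + L * (s / L)\<^sup>2"
      by (simp add: power2_diff sum.distrib sum_subtractf s_def L_def sum_distrib_left[symmetric]
          sum_distrib_right[symmetric] sum_divide_distrib[symmetric] mult_ac)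
    also have "\<dots> = (\<Sum>i\<in>T. (x i j)\<^sup>2) - s\<^sup>2 / L"
      using L by (simp add: power2_eq_square field_simps)
    finally show ?thesis by (simp add: s_def)
  qed
  have "(\<Sum>y\<in>x ` T. sqnorm n (\<lambda>i. y i - centroid (x ` T) i))
      = (\<Sum>i\<in>T. \<Sum>j<n. (x i j - (\<Sum>i\<in>T. x i j) / L)\<^sup>2)"
    using assms by (simp add: sum.reindex sqnorm_def c)
  also have "\<dots> = spread n x T"
    unfolding spread_def L_def[symmetric] by (subst sum.swap) (simp add: col)
  finally show ?thesis
    using assms by (simp add: avg_rad_sq_def card_image)
qed

text \<open>The spread bound acts twice. On indices with distinct images it is the average-radius
  condition. On \<open>L\<close> indices with a common image the spread is 0, which it forbids, so
  fibres of \<open>x\<close> are small and coincidences cost at most a factor \<open>L\<close> in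
  size.\<close>

lemma list_decodable_of_spread:
  assumes J: "finite J" and L: "L \<ge> 1" and N: "N \<ge> 0"
    and ball: "\<And>i. i \<in> J \<Longrightarrow> x i \<in> ballN n (sqrt (real n * P))"
    and spr: "\<And>T. T \<subseteq> J \<Longrightarrow> card T = L \<Longrightarrow> spread n x T > real n * (real L * N)"
  shows "list_decodable n P N L (x ` J) \<and> card J \<le> L * card (x ` J)"
proof
  have "avg_rad_sq n S > real n * N" if S: "S \<subseteq> x ` J" "card S = L" for S
  proof -
    obtain T where T: "T \<subseteq> J" "inj_on x T" "S = x ` T"
      using S(1) by (metis subset_image_inj)
    have cT: "card T = L" using T S by (simp add: card_image)
    have "real L * avg_rad_sq n S = spread n x T"
      using avg_rad_sq_image[OF T(2), of n] cT L T(3) by simp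
    hence "real L * (real n * N) < real L * avg_rad_sq n S"
      using spr[OF T(1) cT] by (simp add: mult.left_commute)
    thus ?thesis using L by simp
  qed
  thus "list_decodable n P N L (x ` J)"
    using J ball by (auto simp: list_decodable_def)
  have fib: "card {i\<in>J. x i = y} \<le> L" for y
  proof (rule ccontr)
    assume "\<not> ?thesis"
    then obtain T where T: "T \<subseteq> {i\<in>J. x i = y}" "card T = L"
      by (metis nat_le_linear obtain_subset_with_card_n)
    have eq: "x i j = y j" if "i \<in> T" for i j using T that by auto
    have "spread n x T = 0"
      using L T(2) by (simp add: spread_def eq power2_eq_square)
    moreover have "T \<subseteq> J" using T(1) by auto
    ultimately show False using spr[of T] T(2) N by (simp add: mult_less_0_iff)
  qed
  have "J = (\<Union>y\<in>x ` J. {i\<in>J. x i = y})" by auto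
  hence "card J \<le> (\<Sum>y\<in>x ` J. card {i\<in>J. x i = y})"
    using card_UN_le[of "x ` J" "\<lambda>y. {i\<in>J. x i = y}"] J by simp
  also have "\<dots> \<le> (\<Sum>y\<in>x ` J. L)" by (intro sum_mono fib)
  finally show "card J \<le> L * card (x ` J)" by (simp add: mult.commute)
qed

section \<open>Concentration of the squared norm of a Gaussian vector\<close>

definition chernoff_factor :: "real \<Rightarrow> real" where
  "chernoff_factor \<delta> = exp (- \<delta> / 2) * sqrt (1 + \<delta>)"

lemma chernoff_factor_nonneg: "\<delta> > -1 \<Longrightarrow> chernoff_factor \<delta> \<ge> 0"
  by (simp add: chernoff_factor_def)

lemma chernoff_factor_less_1:
  assumes "\<delta> > -1" and "\<delta> \<noteq> 0"
  shows "chernoff_factor \<delta> < 1"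
proof -
  have "ln (1 + \<delta>) < \<delta>"
    using assms ln_add_one_self_le_self2[of \<delta>] ln_eq_minus_one[of "1 + \<delta>"] by fastforce
  hence "exp (ln (1 + \<delta>)) < exp \<delta>" by simp
  hence "1 + \<delta> < exp \<delta>" using assms by simp
  hence "sqrt (1 + \<delta>) < sqrt (exp \<delta>)" by simp
  also have "sqrt (exp \<delta>) = exp (\<delta> / 2)"
    by (rule real_sqrt_unique) (auto simp: power2_eq_square exp_add[symmetric])
  finally show ?thesis by (simp add: chernoff_factor_def exp_minus field_simps)
qed

text \<open>With \<open>q\<close> the squared norm of codeword \<open>i\<close>, the weight is
  \<open>exp (\<lambda> * (q - n * (1 + \<delta>)))\<close> for the optimal Chernoff parameter
  \<open>\<lambda> = \<delta> / (2 * (1 + \<delta>))\<close>.\<close>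

lemma nn_integral_row_chernoff:
  assumes "i < M" and \<delta>: "\<delta> > -1"
  shows "(\<integral>\<^sup>+ \<omega>. ennreal (exp (- (real n * \<delta> / 2) + quad_form n \<omega> {i} 0 (- \<delta> / (2 * (1 + \<delta>))))) \<partial>gauss_matrix n M)
       = ennreal (chernoff_factor \<delta> ^ n)"
proof -
  define \<gamma> where "\<gamma> = - \<delta> / (2 * (1 + \<delta>))"
  have \<gamma>: "1 + 2 * \<gamma> = 1 / (1 + \<delta>)" using \<delta> by (simp add: \<gamma>_def field_simps)
  have "(\<integral>\<^sup>+ \<omega>. ennreal (exp (- (real n * \<delta> / 2) + quad_form n \<omega> {i} 0 \<gamma>)) \<partial>gauss_matrix n M)
      = ennreal (exp (- (real n * \<delta> / 2))) * (\<integral>\<^sup>+ \<omega>. ennreal (exp (quad_form n \<omega> {i} 0 \<gamma>)) \<partial>gauss_matrix n M)"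
    using assms(1) unfolding exp_add
    by (subst nn_integral_cmult[symmetric])
       (auto simp: ennreal_mult' intro!: measurable_compose[OF measurable_quad_form])
  also have "\<dots> = ennreal (exp (- (real n * \<delta> / 2))) * ennreal ((1 / sqrt (1 / (1 + \<delta>))) ^ n)"
    using assms by (subst nn_integral_exp_quad_form) (auto simp: \<gamma>)
  also have "\<dots> = ennreal (chernoff_factor \<delta> ^ n)"
    using \<delta> by (simp add: chernoff_factor_def power_mult_distrib ennreal_mult'[symmetric]
        real_sqrt_divide exp_of_nat_mult[symmetric])
  finally show ?thesis by (simp add: \<gamma>_def)
qed

text \<open>The factor \<open>\<delta>\<close> in \<open>ev\<close> treats both tails at once: the
  upper one for \<open>\<delta> > 0\<close>, the lower one for \<open>\<delta> < 0\<close>.\<close>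

lemma row_chernoff_ge_1:
  assumes \<delta>: "\<delta> > -1" and ev: "\<delta> * ((\<Sum>j<n. (\<omega> j i)\<^sup>2) - real n * (1 + \<delta>)) \<ge> 0"
  shows "1 \<le> exp (- (real n * \<delta> / 2) + quad_form n \<omega> {i} 0 (- \<delta> / (2 * (1 + \<delta>))))"
proof -
  have "quad_form n \<omega> {i} 0 (- \<delta> / (2 * (1 + \<delta>))) = \<delta> / (2 * (1 + \<delta>)) * (\<Sum>j<n. (\<omega> j i)\<^sup>2)"
    by (simp add: quad_form_def sum_distrib_left)
  hence "- (real n * \<delta> / 2) + quad_form n \<omega> {i} 0 (- \<delta> / (2 * (1 + \<delta>)))
      = \<delta> * ((\<Sum>j<n. (\<omega> j i)\<^sup>2) - real n * (1 + \<delta>)) / (2 * (1 + \<delta>))"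
    using \<delta> by (simp add: field_simps)
  thus ?thesis using ev \<delta> by simp
qed

section \<open>Exponential tilting of a tuple and the expurgated random code\<close>

locale tilt =
  fixes L :: nat and a b \<epsilon> :: real
  assumes L: "L \<ge> 2" and b: "0 < b" "b \<le> 1" and a: "1 \<le> a"
    and ab: "a + (real L - 1) * b = real L"
    and \<epsilon>: "0 < \<epsilon>" "\<epsilon> < 1"
begin

text \<open>The hypothesis \<open>ab\<close> fixes the trace of the tilted covariance at
  \<open>L\<close>, so tilting keeps the total mean square of a tuple in each coordinate.\<close>

definition \<alpha> where "\<alpha> = (1 / b - 1 / a) / 2"
definition \<beta> where "\<beta> = (1 - 1 / a) / 2"
text \<open>The root of the determinant of the tilted covariance, times the price of knowing the
  squared norms only up to the factor \<open>1 - \<epsilon>\<close>.\<close>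

definition p where "p = exp (real L * \<epsilon> / 2) * sqrt (a * b ^ (L - 1))"

text \<open>With \<open>q\<close> the sum of the squared norms and \<open>s\<close> the spread, the
  form equals \<open>\<beta> * q - \<alpha> * s\<close>.\<close>

definition tuple_weight :: "nat \<Rightarrow> nat set \<Rightarrow> (nat \<Rightarrow> nat \<Rightarrow> real) \<Rightarrow> real" where
  "tuple_weight n T \<omega> = exp (real n * (real L * \<epsilon> / 2) + quad_form n \<omega> T (\<alpha> / L) (\<alpha> - \<beta>))"

lemma \<alpha>_nonneg: "\<alpha> \<ge> 0"
proof -
  have "1 / a \<le> 1 / b" using a b by (intro divide_left_mono) auto
  thus ?thesis by (simp add: \<alpha>_def)
qed

lemma nn_integral_tuple_weight:
  assumes T: "T \<subseteq> {..<M}" "card T = L"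
  shows "(\<integral>\<^sup>+ \<omega>. ennreal (tuple_weight n T \<omega>) \<partial>gauss_matrix n M) = ennreal (p ^ n)"
proof -
  have Lpos: "real L > 0" using L by simp
  have g: "1 + 2 * (\<alpha> - \<beta>) = 1 / b" by (simp add: \<alpha>_def \<beta>_def field_simps)
  have kL: "2 * (\<alpha> / L) * L = 1 / b - 1 / a" using Lpos by (simp add: \<alpha>_def)
  \<comment> \<open>The diagonal direction has ratio \<open>b / a\<close>, which trades one factor
    \<open>b\<close> of the power \<open>b ^ L\<close> for \<open>a\<close>.\<close>
  have v: "(1 / sqrt (1 / b)) ^ L / sqrt (1 - (1 / b - 1 / a) / (1 / b)) = sqrt (a * b ^ (L - 1))"
  proof -
    have "1 - (1 / b - 1 / a) / (1 / b) = b / a" using a b by (simp add: field_simps)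
    moreover obtain k where k: "L = Suc k" using L by (cases L) auto
    ultimately show ?thesis
      using a b by (simp add: real_sqrt_divide real_sqrt_mult real_sqrt_power field_simps)
  qed
  have "(\<integral>\<^sup>+ \<omega>. ennreal (tuple_weight n T \<omega>) \<partial>gauss_matrix n M)
      = ennreal (exp (real n * (real L * \<epsilon> / 2)))
        * (\<integral>\<^sup>+ \<omega>. ennreal (exp (quad_form n \<omega> T (\<alpha> / L) (\<alpha> - \<beta>))) \<partial>gauss_matrix n M)"
    using T(1) unfolding tuple_weight_def exp_add
    by (subst nn_integral_cmult[symmetric])
       (auto simp: ennreal_mult' intro!: measurable_compose[OF measurable_quad_form])
  also have "\<dots> = ennreal (exp (real n * (real L * \<epsilon> / 2))) * ennreal (sqrt (a * b ^ (L - 1)) ^ n)"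
  proof (subst nn_integral_exp_quad_form)
    show "0 < 1 + 2 * (\<alpha> - \<beta>)" unfolding g using b by simp
    show "2 * (\<alpha> / L) * card T < 1 + 2 * (\<alpha> - \<beta>)" unfolding g T kL using a by simp
  qed (use T \<alpha>_nonneg in \<open>simp_all only: g kL v T, simp_all\<close>)
  also have "\<dots> = ennreal (p ^ n)"
    by (simp add: p_def power_mult_distrib ennreal_mult'[symmetric] exp_of_nat_mult[symmetric])
  finally show ?thesis .
qed

text \<open>At \<open>q = n * L\<close> and the largest allowed spread, \<open>\<beta> * q\<close>
  and \<open>\<alpha> * s\<close> cancel. The deficit of \<open>q\<close> costs at most
  \<open>\<beta> * L * n * \<epsilon>\<close>, which the slack in the weight covers since
  \<open>\<beta> \<le> 1 / 2\<close>.\<close>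

lemma tuple_weight_ge_1:
  assumes T: "card T = L" and low: "\<And>i. i \<in> T \<Longrightarrow> (\<Sum>j<n. (\<omega> j i)\<^sup>2) \<ge> real n * (1 - \<epsilon>)"
    and spr: "spread n (\<lambda>i j. \<omega> j i) T \<le> real n * ((real L - 1) * b)"
  shows "1 \<le> tuple_weight n T \<omega>"
proof -
  define s where "s = spread n (\<lambda>i j. \<omega> j i) T"
  define q where "q = (\<Sum>i\<in>T. \<Sum>j<n. (\<omega> j i)\<^sup>2)"
  have "(\<Sum>i\<in>T. real n * (1 - \<epsilon>)) \<le> q" unfolding q_def by (intro sum_mono low)
  hence q: "real L * (real n * (1 - \<epsilon>)) \<le> q" using T by simp
  have \<beta>: "0 \<le> \<beta>" "\<beta> \<le> 1 / 2" using a by (auto simp: \<beta>_def field_simps)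
  have "quad_form n \<omega> T (\<alpha> / L) (\<alpha> - \<beta>) = \<beta> * q - \<alpha> * s"
  proof -
    define A where "A j = (\<Sum>i\<in>T. (\<omega> j i)\<^sup>2)" for j
    define S where "S j = (\<Sum>i\<in>T. \<omega> j i)\<^sup>2" for j
    have "q = (\<Sum>j<n. A j)" unfolding q_def A_def by (rule sum.swap)
    moreover have "s = (\<Sum>j<n. A j - S j / L)" by (simp add: s_def spread_def A_def S_def T)
    moreover have "quad_form n \<omega> T (\<alpha> / L) (\<alpha> - \<beta>) = (\<Sum>j<n. \<alpha> / L * S j - (\<alpha> - \<beta>) * A j)"
      by (simp add: quad_form_def A_def S_def)
    ultimately show ?thesis
      by (simp add: sum_distrib_left sum_subtractf[symmetric] algebra_simps)
  qed
  moreover have "\<alpha> * s \<le> \<alpha> * (real n * ((real L - 1) * b))"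
    using spr \<alpha>_nonneg unfolding s_def by (rule mult_left_mono)
  moreover have "\<beta> * (real L * (real n * (1 - \<epsilon>))) \<le> \<beta> * q"
    using q \<beta>(1) by (rule mult_left_mono)
  \<comment> \<open>This is where the trace condition \<open>ab\<close> enters, as
    \<open>(L - 1) * b = L - a\<close>.\<close>
  moreover have "\<alpha> * ((real L - 1) * b) = \<beta> * real L"
  proof -
    have e: "(real L - 1) * b = real L - a" using ab by simp
    have "\<alpha> * ((real L - 1) * b) = ((real L - 1) - ((real L - 1) * b) / a) / 2"
      using b a by (simp add: \<alpha>_def field_simps)
    also have "\<dots> = \<beta> * real L"
      unfolding e using a by (simp add: \<beta>_def field_simps)
    finally show ?thesis .
  qed
  hence "\<alpha> * (real n * ((real L - 1) * b)) = real n * (\<beta> * real L)"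
    by (metis mult.left_commute)
  moreover have "\<beta> * (real L * real n * \<epsilon>) \<le> 1 / 2 * (real L * real n * \<epsilon>)"
    using \<beta> \<epsilon> by (intro mult_right_mono) auto
  ultimately have "0 \<le> real n * (real L * \<epsilon> / 2) + quad_form n \<omega> T (\<alpha> / L) (\<alpha> - \<beta>)"
    by (simp add: algebra_simps)
  thus ?thesis by (simp add: tuple_weight_def)
qed

lemma exists_good_rows:
  assumes M: "M \<ge> 1"
    and small: "chernoff_factor \<epsilon> ^ n + chernoff_factor (- \<epsilon>) ^ n + real M ^ (L - 1) * p ^ n < 1 / 2"
  shows "\<exists>\<omega>. \<exists>J\<subseteq>{..<M}. real M / 2 \<le> card J \<and>
     (\<forall>i\<in>J. (\<Sum>j<n. (\<omega> j i)\<^sup>2) \<le> real n * (1 + \<epsilon>)) \<and>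
     (\<forall>T\<subseteq>J. card T = L \<longrightarrow> spread n (\<lambda>i j. \<omega> j i) T > real n * ((real L - 1) * b))"
proof -
  interpret prob_space "gauss_matrix n M" by (rule prob_space_gauss_matrix)
  define E where "E \<delta> i \<omega> = exp (- (real n * \<delta> / 2) + quad_form n \<omega> {i} 0 (- \<delta> / (2 * (1 + \<delta>))))"
    for \<delta> i and \<omega> :: "nat \<Rightarrow> nat \<Rightarrow> real"
  define \<S> where "\<S> = {T. T \<subseteq> {..<M} \<and> card T = L}"
  have fS: "finite \<S>" unfolding \<S>_def by simp
  have E0: "0 \<le> E \<delta> i \<omega>" for \<delta> i \<omega> by (simp add: E_def)
  have W0: "0 \<le> tuple_weight n T \<omega>" for T \<omega> by (simp add: tuple_weight_def)
  have p0: "p \<ge> 0" using a b by (simp add: p_def)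
  \<comment> \<open>Dominates the number of codewords with atypical norm plus the number of bad
    tuples of typical codewords. An expectation below \<open>M / 2\<close> leaves at least half of
    the codewords after deletion.\<close>
  define F where "F \<omega> = (\<Sum>i<M. E \<epsilon> i \<omega>) + (\<Sum>i<M. E (- \<epsilon>) i \<omega>) + (\<Sum>T\<in>\<S>. tuple_weight n T \<omega>)" for \<omega>
  have Em: "(\<lambda>\<omega>. ennreal (E \<delta> i \<omega>)) \<in> borel_measurable (gauss_matrix n M)" if "i < M" for \<delta> i
    unfolding E_def using that
    by (intro measurable_compose[OF measurable_quad_form[of "{i}" M n]]) auto
  have Wm: "(\<lambda>\<omega>. ennreal (tuple_weight n T \<omega>)) \<in> borel_measurable (gauss_matrix n M)" if "T \<in> \<S>" for T
    unfolding tuple_weight_def using that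
    by (intro measurable_compose[OF measurable_quad_form[of T M n]]) (auto simp: \<S>_def)
  have Ei: "(\<integral>\<^sup>+ \<omega>. (\<Sum>i<M. ennreal (E \<delta> i \<omega>)) \<partial>gauss_matrix n M) = ennreal (M * chernoff_factor \<delta> ^ n)"
    if "\<delta> > -1" for \<delta>
  proof -
    have "(\<integral>\<^sup>+ \<omega>. ennreal (E \<delta> i \<omega>) \<partial>gauss_matrix n M) = ennreal (chernoff_factor \<delta> ^ n)" if "i < M" for i
      unfolding E_def using that \<open>\<delta> > -1\<close> by (rule nn_integral_row_chernoff)
    hence "(\<integral>\<^sup>+ \<omega>. (\<Sum>i<M. ennreal (E \<delta> i \<omega>)) \<partial>gauss_matrix n M) = (\<Sum>i<M. ennreal (chernoff_factor \<delta> ^ n))"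
      using Em by (subst nn_integral_sum) auto
    thus ?thesis using that chernoff_factor_nonneg[OF that] by (simp add: ennreal_mult' ennreal_of_nat_eq_real_of_nat)
  qed
  have Wi: "(\<integral>\<^sup>+ \<omega>. (\<Sum>T\<in>\<S>. ennreal (tuple_weight n T \<omega>)) \<partial>gauss_matrix n M) = ennreal (card \<S> * p ^ n)"
  proof -
    have "(\<integral>\<^sup>+ \<omega>. ennreal (tuple_weight n T \<omega>) \<partial>gauss_matrix n M) = ennreal (p ^ n)" if "T \<in> \<S>" for T
      using that by (intro nn_integral_tuple_weight) (auto simp: \<S>_def)
    hence "(\<integral>\<^sup>+ \<omega>. (\<Sum>T\<in>\<S>. ennreal (tuple_weight n T \<omega>)) \<partial>gauss_matrix n M) = (\<Sum>T\<in>\<S>. ennreal (p ^ n))"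
      using Wm by (subst nn_integral_sum) auto
    thus ?thesis using p0 by (simp add: ennreal_mult' ennreal_of_nat_eq_real_of_nat)
  qed
  have cS: "real (card \<S>) \<le> real M ^ L"
  proof (cases "L \<le> M")
    case True
    have "card \<S> = M choose L" unfolding \<S>_def by (simp add: n_subsets)
    also have "\<dots> \<le> M ^ L" by (rule binomial_le_pow[OF True])
    finally show ?thesis by (metis of_nat_le_iff of_nat_power)
  next
    case False
    thus ?thesis unfolding \<S>_def by (simp add: n_subsets binomial_eq_0)
  qed
  have "(\<integral>\<^sup>+ \<omega>. ennreal (F \<omega>) \<partial>gauss_matrix n M)
     = (\<integral>\<^sup>+ \<omega>. (\<Sum>i<M. ennreal (E \<epsilon> i \<omega>)) + (\<Sum>i<M. ennreal (E (- \<epsilon>) i \<omega>))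
          + (\<Sum>T\<in>\<S>. ennreal (tuple_weight n T \<omega>)) \<partial>gauss_matrix n M)"
    unfolding F_def by (intro nn_integral_cong) (simp add: E0 W0 sum_nonneg)
  also have "\<dots> = ennreal (M * chernoff_factor \<epsilon> ^ n) + ennreal (M * chernoff_factor (- \<epsilon>) ^ n) + ennreal (card \<S> * p ^ n)"
  proof -
    have "(\<lambda>\<omega>. \<Sum>i<M. ennreal (E \<delta> i \<omega>)) \<in> borel_measurable (gauss_matrix n M)" for \<delta>
      by (intro borel_measurable_sum Em) auto
    moreover have "(\<lambda>\<omega>. \<Sum>T\<in>\<S>. ennreal (tuple_weight n T \<omega>)) \<in> borel_measurable (gauss_matrix n M)"
      by (intro borel_measurable_sum Wm)
    ultimately show ?thesis
      using \<epsilon> by (simp add: nn_integral_add Ei Wi)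
  qed
  also have "\<dots> = ennreal (M * chernoff_factor \<epsilon> ^ n + M * chernoff_factor (- \<epsilon>) ^ n + card \<S> * p ^ n)"
    using \<epsilon> p0 chernoff_factor_nonneg[of \<epsilon>] chernoff_factor_nonneg[of "- \<epsilon>"] by simp
  also have "\<dots> < ennreal (M / 2)"
  proof (rule ennreal_lessI)
    show "0 < real M / 2" using M by simp
    have "card \<S> * p ^ n \<le> real M ^ L * p ^ n" using cS p0 by (intro mult_right_mono) auto
    also have "real M ^ L * p ^ n = M * (real M ^ (L - 1) * p ^ n)"
      using L by (cases L) auto
    finally have "M * chernoff_factor \<epsilon> ^ n + M * chernoff_factor (- \<epsilon>) ^ n + card \<S> * p ^ n
        \<le> M * (chernoff_factor \<epsilon> ^ n + chernoff_factor (- \<epsilon>) ^ n + real M ^ (L - 1) * p ^ n)"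
      by (simp add: algebra_simps)
    also have "\<dots> < M * (1 / 2)" using small M by (intro mult_strict_left_mono) auto
    finally show "M * chernoff_factor \<epsilon> ^ n + M * chernoff_factor (- \<epsilon>) ^ n + card \<S> * p ^ n < real M / 2" by simp
  qed
  finally obtain \<omega> where \<omega>: "F \<omega> < real M / 2"
    using exists_less_of_nn_integral_less by blast
  define B1 where "B1 = {i\<in>{..<M}. (\<Sum>j<n. (\<omega> j i)\<^sup>2) > real n * (1 + \<epsilon>)}"
  define B2 where "B2 = {i\<in>{..<M}. (\<Sum>j<n. (\<omega> j i)\<^sup>2) < real n * (1 - \<epsilon>)}"
  \<comment> \<open>Only tuples avoiding \<open>B2\<close> have the norm lower bound that makes
    their weight at least 1; deleting \<open>B1\<close> serves the ball constraint.\<close>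
  define \<T> where "\<T> = {T. T \<subseteq> {..<M} - (B1 \<union> B2) \<and> card T = L \<and> spread n (\<lambda>i j. \<omega> j i) T \<le> real n * ((real L - 1) * b)}"
  have fin: "finite B1" "finite B2" "\<T> \<subseteq> \<S>" by (auto simp: B1_def B2_def \<T>_def \<S>_def)
  have count: "real (card B) \<le> (\<Sum>k\<in>A. w k)"
    if "finite A" "B \<subseteq> A" "\<And>k. k \<in> B \<Longrightarrow> 1 \<le> w k" "\<And>k. 0 \<le> w k" for A B and w :: "'b \<Rightarrow> real"
  proof -
    have "real (card B) = (\<Sum>k\<in>B. 1)" by simp
    also have "\<dots> \<le> (\<Sum>k\<in>B. w k)" using that by (intro sum_mono) auto
    also have "\<dots> \<le> (\<Sum>k\<in>A. w k)" using that by (intro sum_mono2) auto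
    finally show ?thesis .
  qed
  have "real (card B1) \<le> (\<Sum>i<M. E \<epsilon> i \<omega>)"
    using \<epsilon> unfolding E_def
    by (intro count row_chernoff_ge_1) (auto simp: B1_def)
  moreover have "real (card B2) \<le> (\<Sum>i<M. E (- \<epsilon>) i \<omega>)"
    using \<epsilon> unfolding E_def
    by (intro count row_chernoff_ge_1) (auto simp: B2_def intro!: mult_nonneg_nonpos)
  moreover have "real (card \<T>) \<le> (\<Sum>T\<in>\<S>. tuple_weight n T \<omega>)"
  proof (intro count fS fin W0)
    fix T assume T: "T \<in> \<T>"
    show "1 \<le> tuple_weight n T \<omega>"
    proof (rule tuple_weight_ge_1)
      fix i assume "i \<in> T"
      hence "i < M" "i \<notin> B2" using T by (auto simp: \<T>_def)
      thus "real n * (1 - \<epsilon>) \<le> (\<Sum>j<n. (\<omega> j i)\<^sup>2)" by (auto simp: B2_def)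
    qed (use T in \<open>auto simp: \<T>_def\<close>)
  qed
  moreover have "real (card (B1 \<union> B2)) \<le> card B1 + card B2"
    using card_Un_le[of B1 B2] by linarith
  ultimately have few: "real (card (B1 \<union> B2)) + card \<T> < M / 2"
    using \<omega> by (simp add: F_def)
  have "finite \<T>" using fin(3) fS finite_subset by blast
  moreover have "{} \<notin> \<T>" using L by (auto simp: \<T>_def)
  moreover have "B1 \<union> B2 \<subseteq> {..<M}" by (auto simp: B1_def B2_def)
  ultimately obtain J where J: "J \<subseteq> {..<M} - (B1 \<union> B2)" "\<forall>T\<in>\<T>. \<not> T \<subseteq> J"
      "M \<le> card J + card (B1 \<union> B2) + card \<T>"
    using expurgation[of "{..<M}" "B1 \<union> B2" \<T>] by auto
  have "real M / 2 \<le> card J" using J(3) few by linarith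
  moreover have "\<forall>i\<in>J. (\<Sum>j<n. (\<omega> j i)\<^sup>2) \<le> real n * (1 + \<epsilon>)"
    using J(1) by (force simp: B1_def)
  moreover have "spread n (\<lambda>i j. \<omega> j i) T > real n * ((real L - 1) * b)" if "T \<subseteq> J" "card T = L" for T
  proof (rule ccontr)
    assume "\<not> ?thesis"
    hence "T \<in> \<T>" using that J(1) by (auto simp: \<T>_def)
    thus False using J(2) that by blast
  qed
  ultimately show ?thesis using J(1) by blast
qed

end

section \<open>Rescaling into the ball and asymptotic rate\<close>

context tilt
begin

text \<open>Scaling by \<open>\<sigma>\<close> turns the norm bound
  \<open>n * (1 + \<epsilon>)\<close> into \<open>n * P\<close> and, by \<open>bN\<close>, the
  spread threshold into \<open>n * L * N\<close>.\<close>

lemma exists_code: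
  assumes P: "P > 0" and N: "N > 0" and bN: "(real L - 1) * b = real L * N * (1 + \<epsilon>) / P"
    and M: "M \<ge> 1"
    and small: "chernoff_factor \<epsilon> ^ n + chernoff_factor (- \<epsilon>) ^ n + real M ^ (L - 1) * p ^ n < 1 / 2"
  shows "\<exists>C. list_decodable n P N L C \<and> real M / 2 \<le> real L * real (card C)"
proof -
  obtain \<omega> J where J: "J \<subseteq> {..<M}" "real M / 2 \<le> card J"
      and up: "\<And>i. i \<in> J \<Longrightarrow> (\<Sum>j<n. (\<omega> j i)\<^sup>2) \<le> real n * (1 + \<epsilon>)"
      and spr: "\<And>T. T \<subseteq> J \<Longrightarrow> card T = L \<Longrightarrow> spread n (\<lambda>i j. \<omega> j i) T > real n * ((real L - 1) * b)"
    using exists_good_rows[OF M small] by blast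
  define \<sigma> where "\<sigma> = sqrt (P / (1 + \<epsilon>))"
  have \<sigma>2: "\<sigma>\<^sup>2 = P / (1 + \<epsilon>)" using P \<epsilon> by (simp add: \<sigma>_def)
  have \<sigma>pos: "\<sigma>\<^sup>2 > 0" using P \<epsilon> by (simp add: \<sigma>2)
  \<comment> \<open>Transposes the matrix, so that codewords are indexed first, and pads with zeros
    as \<open>in_Rn\<close> demands.\<close>
  define x where "x i j = (if j < n then \<sigma> * \<omega> j i else 0)" for i j
  have ball: "x i \<in> ballN n (sqrt (real n * P))" if "i \<in> J" for i
  proof -
    have "sqnorm n (x i) = \<sigma>\<^sup>2 * (\<Sum>j<n. (\<omega> j i)\<^sup>2)"
      by (simp add: sqnorm_def x_def power_mult_distrib sum_distrib_left)
    also have "\<dots> \<le> \<sigma>\<^sup>2 * (real n * (1 + \<epsilon>))" using up[OF that] by (intro mult_left_mono) auto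
    also have "\<dots> = real n * P" using \<epsilon> by (simp add: \<sigma>2)
    finally show ?thesis by (simp add: ballN_def in_Rn_def x_def)
  qed
  have spread_x: "spread n x T > real n * (real L * N)" if T: "T \<subseteq> J" "card T = L" for T
  proof -
    have "spread n x T = \<sigma>\<^sup>2 * spread n (\<lambda>i j. \<omega> j i) T"
      by (simp add: spread_def x_def power_mult_distrib sum_distrib_left[symmetric] right_diff_distrib[symmetric]
          times_divide_eq_right[symmetric] del: times_divide_eq_right)
    also have "\<dots> > \<sigma>\<^sup>2 * (real n * ((real L - 1) * b))"
      using spr[OF T] \<sigma>pos by (rule mult_strict_left_mono)
    also have "\<sigma>\<^sup>2 * (real n * ((real L - 1) * b)) = real n * (real L * N)"
      unfolding bN \<sigma>2 using P \<epsilon> by simp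
    finally show ?thesis .
  qed
  have fJ: "finite J" using J(1) finite_subset by blast
  have "list_decodable n P N L (x ` J) \<and> card J \<le> L * card (x ` J)"
    using L N fJ by (intro list_decodable_of_spread ball spread_x) auto
  moreover from this have "real (card J) \<le> real L * real (card (x ` J))"
    by (metis of_nat_le_iff of_nat_mult)
  ultimately show ?thesis using J(2) by (intro exI[of _ "x ` J"]) auto
qed

text \<open>With \<open>M\<close> the integer part of \<open>exp (n * R')\<close>, the tuple term is
  at most \<open>(exp (R' * (L - 1)) * p) ^ n\<close>, which vanishes by \<open>pR\<close>. The gap
  between \<open>R\<close> and \<open>R'\<close> absorbs constant factors.\<close>

lemma list_capacity_ge:
  assumes P: "P > 0" and N: "N > 0" and bN: "(real L - 1) * b = real L * N * (1 + \<epsilon>) / P"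
    and R: "0 \<le> R" "R < R'" and pR: "exp (R' * (real L - 1)) * p < 1"
  shows "ereal R \<le> list_capacity L P N"
proof -
  define r where "r = exp (R' * (real L - 1)) * p"
  have p0: "p \<ge> 0" using a b by (simp add: p_def)
  have r: "0 \<le> r" "r < 1" using p0 pR by (auto simp: r_def)
  have "(\<lambda>n. chernoff_factor \<epsilon> ^ n + chernoff_factor (- \<epsilon>) ^ n + r ^ n) \<longlonglongrightarrow> 0 + 0 + 0"
    using \<epsilon> r chernoff_factor_nonneg[of \<epsilon>] chernoff_factor_nonneg[of "-\<epsilon>"]
      chernoff_factor_less_1[of \<epsilon>] chernoff_factor_less_1[of "-\<epsilon>"]
    by (intro tendsto_add LIMSEQ_realpow_zero) auto
  hence "\<forall>\<^sub>F n in sequentially. chernoff_factor \<epsilon> ^ n + chernoff_factor (- \<epsilon>) ^ n + r ^ n < 1 / 2"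
    by (rule order_tendstoD(2)) simp
  \<comment> \<open>The constant collects 2 for rounding \<open>M\<close>, 2 for expurgation and
    \<open>L\<close> for coinciding codewords.\<close>
  moreover obtain k where k: "4 * real L < exp (R' - R) ^ k"
    using real_arch_pow[of "exp (R' - R)"] R by auto
  have "\<forall>\<^sub>F n in sequentially. 4 * real L \<le> exp (R' - R) ^ n"
    using eventually_ge_at_top[of k]
  proof eventually_elim
    case (elim n)
    hence "exp (R' - R) ^ k \<le> exp (R' - R) ^ n" using R by (intro power_increasing) auto
    thus ?case using k by simp
  qed
  moreover have "\<forall>\<^sub>F n in sequentially. n \<ge> (1::nat)" by (rule eventually_ge_at_top)
  ultimately have "\<forall>\<^sub>F n in sequentially. ereal R \<le> (SUP C\<in>{C. list_decodable n P N L C}. ereal (code_rate n C))"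
  proof eventually_elim
    case (elim n)
    define e where "e = exp (real n * R')"
    define M where "M = nat \<lfloor>e\<rfloor>"
    have e1: "e \<ge> 1" using R by (simp add: e_def)
    have M1: "M \<ge> 1" using e1 by (simp add: M_def le_nat_iff)
    have Me: "real M \<le> e" "e \<le> 2 * real M"
      using e1 M1 by (auto simp: M_def) linarith+
    have "real M ^ (L - 1) * p ^ n \<le> e ^ (L - 1) * p ^ n"
      using Me p0 by (intro mult_right_mono power_mono) auto
    also have "e ^ (L - 1) * p ^ n = r ^ n"
      using L by (simp add: e_def r_def power_mult_distrib exp_of_nat_mult[symmetric] of_nat_diff mult_ac)
    finally have "chernoff_factor \<epsilon> ^ n + chernoff_factor (- \<epsilon>) ^ n + real M ^ (L - 1) * p ^ n < 1 / 2"
      using elim(1) by linarith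
    then obtain C where C: "list_decodable n P N L C" "real M / 2 \<le> real L * real (card C)"
      using exists_code[OF P N bN M1] by blast
    have "4 * real L * exp (real n * R) \<le> exp (R' - R) ^ n * exp (real n * R)"
      using elim(2) by (intro mult_right_mono) auto
    also have "\<dots> = e"
      by (simp add: e_def exp_of_nat_mult[symmetric] exp_add[symmetric] algebra_simps)
    also have "\<dots> \<le> 4 * real L * real (card C)" using Me C(2) by linarith
    finally have "exp (real n * R) \<le> real (card C)" using L by simp
    hence "real n * R \<le> ln (real (card C))"
      by (metis exp_gt_zero ln_exp ln_le_cancel_iff less_le_trans)
    hence "R \<le> code_rate n C" using elim(3) by (simp add: code_rate_def field_simps)
    thus ?case using C(1) by (intro SUP_upper2[of C]) auto
  qed
  thus ?thesis unfolding list_capacity_def by (intro le_Limsup) auto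
qed

end

section \<open>Nonnegativity of the capacity and the limit of vanishing slack\<close>

lemma list_capacity_nonneg: "0 \<le> list_capacity L P N" if "L \<ge> 1"
proof -
  have "0 \<le> (SUP C\<in>{C. list_decodable n P N L C}. ereal (code_rate n C))" for n
  proof (rule SUP_upper2[of "{}"])
    show "{} \<in> {C. list_decodable n P N L C}" using that by (auto simp: list_decodable_def)
  \<comment> \<open>The empty code has rate 0, since \<open>ln 0 = 0\<close>.\<close>
  qed (simp add: code_rate_def)
  thus ?thesis unfolding list_capacity_def by (intro le_Limsup) auto
qed

theorem mainTheorem7:
  fixes P N :: real and L :: nat
  assumes "P > 0" and "N > 0" and "L \<ge> 2"
    and "N / P \<le> (real L - 1) / real L"
  shows "list_capacity L P N \<ge>
    ereal ((1/2) * (ln ((real L - 1) * P / (real L * N))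
                    + (1 / (real L - 1)) * ln (P / (real L * (P - N)))))"
proof (rule ccontr)
  \<comment> \<open>The claimed bound as a function of \<open>N\<close>, to be evaluated at a
    slightly enlarged \<open>N\<close> too.\<close>
  define \<phi> where "\<phi> N = (1/2) * (ln ((real L - 1) * P / (real L * N))
                    + (1 / (real L - 1)) * ln (P / (real L * (P - N))))" for N
  assume "\<not> ?thesis"
  hence "list_capacity L P N < ereal (\<phi> N)" by (simp add: \<phi>_def not_le)
  then obtain R where R: "list_capacity L P N < ereal R" "R < \<phi> N"
    using ereal_dense2 by (metis less_ereal.simps(1))
  have R0: "0 \<le> R"
    using list_capacity_nonneg[of L P N] R(1) assms(3) by (cases "list_capacity L P N") auto
  have L1: "real L - 1 > 0" using assms(3) by simp
  have NP: "real L * N \<le> (real L - 1) * P" using assms L1 by (simp add: field_simps)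
  \<comment> \<open>At equality both logarithms vanish, contradicting
    \<open>0 \<le> R < \<phi> N\<close>. Strictness leaves room to enlarge \<open>N\<close>.\<close>
  have "real L * N \<noteq> (real L - 1) * P"
  proof
    assume eq: "real L * N = (real L - 1) * P"
    have "real L * (P - N) = P" using eq by (simp add: algebra_simps)
    hence "\<phi> N = 0" using eq assms L1 by (simp add: \<phi>_def)
    thus False using R0 R(2) by simp
  qed
  hence NP: "real L * N < (real L - 1) * P" using NP by simp
  have "(real L - 1) * P < real L * P" using assms by simp
  with NP have "real L * N < real L * P" by linarith
  hence NltP: "N < P" using assms by simp
  define R' where "R' = (R + \<phi> N) / 2"
  have R': "R < R'" "R' < \<phi> N" using R(2) by (auto simp: R'_def field_simps)
  \<comment> \<open>For the \<open>p\<close> of slack \<open>\<epsilon>\<close> this is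
    \<open>- ln p / (L - 1)\<close>; the subtracted term comes from the factor
    \<open>exp (L * \<epsilon> / 2)\<close> in \<open>p\<close>.\<close>
  define \<psi> where "\<psi> \<epsilon> = \<phi> (N * (1 + \<epsilon>)) - real L * \<epsilon> / (2 * (real L - 1))" for \<epsilon>
  have "(\<psi> \<longlongrightarrow> \<phi> (N * (1 + 0)) - real L * 0 / (2 * (real L - 1))) (at_right 0)"
    unfolding \<psi>_def \<phi>_def using assms L1 NltP
    by (intro tendsto_intros) auto
  hence "\<forall>\<^sub>F \<epsilon> in at_right 0. \<psi> \<epsilon> > R'" using R' by (intro order_tendstoD(1)) auto
  moreover have "((\<lambda>\<epsilon>. real L * (N * (1 + \<epsilon>))) \<longlongrightarrow> real L * (N * (1 + 0))) (at_right 0)"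
    by (intro tendsto_intros)
  hence "\<forall>\<^sub>F \<epsilon> in at_right 0. real L * (N * (1 + \<epsilon>)) < (real L - 1) * P"
    using NP by (intro order_tendstoD(2)) auto
  moreover have "\<forall>\<^sub>F \<epsilon> in at_right (0::real). \<epsilon> \<in> {0<..<1}"
    by (rule eventually_at_right_real) simp
  ultimately have "\<forall>\<^sub>F \<epsilon> in at_right 0. \<psi> \<epsilon> > R' \<and> real L * (N * (1 + \<epsilon>)) < (real L - 1) * P \<and> \<epsilon> \<in> {0<..<1}"
    by eventually_elim auto
  then obtain \<epsilon> where eps: "\<psi> \<epsilon> > R'" "real L * (N * (1 + \<epsilon>)) < (real L - 1) * P" "0 < \<epsilon>" "\<epsilon> < 1"
    using eventually_happens'[of "at_right (0::real)"] by auto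
  define N' where "N' = N * (1 + \<epsilon>)"
  have N': "N' > 0" "real L * N' < (real L - 1) * P" using assms eps by (auto simp: N'_def)
  \<comment> \<open>\<open>b\<close> is forced by the relation \<open>bN\<close>, and then
    \<open>a\<close> by the trace condition.\<close>
  define a where "a = real L * (P - N') / P"
  define b where "b = real L * N' / ((real L - 1) * P)"
  have b: "0 < b" "b < 1" using N' L1 assms by (auto simp: b_def)
  have a: "1 < a" using N' assms by (simp add: a_def field_simps)
  have b': "(real L - 1) * b = real L * N' / P" using L1 by (simp add: b_def)
  interpret tilt L a b \<epsilon>
  proof
    show "a + (real L - 1) * b = real L" unfolding b' using assms by (simp add: a_def field_simps)
  qed (use a b assms eps in auto)
  have \<phi>: "\<phi> N' = - (ln b + ln a / (real L - 1)) / 2"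
  proof -
    have "(real L - 1) * P / (real L * N') = inverse b" "P / (real L * (P - N')) = inverse a"
      by (auto simp: a_def b_def)
    thus ?thesis using a b by (simp add: \<phi>_def ln_inverse)
  qed
  have p_pos: "p > 0" using a b by (simp add: p_def)
  have "ln p = real L * \<epsilon> / 2 + (ln a + (real L - 1) * ln b) / 2"
    using a b assms(3) by (simp add: p_def ln_mult ln_sqrt ln_realpow of_nat_diff)
  moreover have "R' * (real L - 1) < \<psi> \<epsilon> * (real L - 1)"
    using eps(1) L1 by (rule mult_strict_right_mono)
  moreover have "\<psi> \<epsilon> * (real L - 1) = - ((real L - 1) * ln b + ln a) / 2 - real L * \<epsilon> / 2"
  proof -
    have "(- (u + v / K) / 2 - w / (2 * K)) * K = - (K * u + v) / 2 - w / 2" if "K > 0" for K u v w :: real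
      using that by (simp add: field_simps)
    from this[OF L1] show ?thesis by (simp add: \<psi>_def N'_def[symmetric] \<phi>)
  qed
  ultimately have "R' * (real L - 1) + ln p < 0" by (simp add: field_simps)
  hence "exp (R' * (real L - 1) + ln p) < 1" by simp
  hence "exp (R' * (real L - 1)) * p < 1" using p_pos by (simp add: exp_add)
  hence "ereal R \<le> list_capacity L P N"
    using assms R0 R'(1) b' by (intro list_capacity_ge) (auto simp: N'_def mult_ac)
  thus False using R(1) by simp
qed

end
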